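(* Let $(\mathcal{V},g)$ be a finite-dimensional real vector space with a positive definite scalar product, and let $R$ be an algebraic curvature tensor on $(\mathcal{V},g)$. If $R$ is Jacobi-orthogonal, then $R$ is Osserman.
   Context: An algebraic curvature tensor on $(\mathcal{V},g)$ is a 4-linear form $R\colon\mathcal{V}^4\to\mathbb{R}$ satisfying $R(X,Y,Z,W)=-R(Y,X,Z,W)=-R(X,Y,W,Z)=R(Z,W,X,Y)$ and the first Bianchi identity $R(X,Y,Z,W)+R(Y,Z,X,W)+R(Z,X,Y,W)=0$ for all $X,Y,Z,W\in\mathcal{V}$. The associated curvature operator $\mathcal{R}$ is defined by $g(\mathcal{R}(X,Y)Z,W)=R(X,Y,Z,W)$. For $X\in\mathcal{V}$, the Jacobi operator is the self-adjoint linear operator $\mathcal{J}_X\colon\mathcal{V}\to\mathcal{V}$, $\mathcal{J}_XY=\mathcal{R}(Y,X)X$. For nonzero $X$, the reduced Jacobi operator $\widetilde{\mathcal{J}}_X\colon X^\perp\to X^\perp$ is the restriction of $\mathcal{J}_X$ to the orthogonal complement $X^\perp$ of $X$. $R$ is Jacobi-orthogonal if $g(\mathcal{J}_XY,\mathcal{J}_YX)=0$ for all $X,Y\in\mathcal{V}$ with $g(X,Y)=0$. $R$ is Osserman if the characteristic polynomial $\det(\lambda\,\mathrm{Id}-\widetilde{\mathcal{J}}_X)$ is the same for all unit vectors $X\in\mathcal{V}$. *)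

theory Defs
  imports "HOL-Analysis.Analysis" "Jordan_Normal_Form.Char_Poly"
begin

section \<open>Characteristic polynomial of an operator on a subspace\<close>

definition basis_list :: "'a::real_vector set \<Rightarrow> 'a list \<Rightarrow> bool" where
  "basis_list S bs \<longleftrightarrow> distinct bs \<and> independent (set bs) \<and> span (set bs) = S"

definition matrix_wrt :: "'a::real_vector list \<Rightarrow> ('a \<Rightarrow> 'a) \<Rightarrow> real mat" where
  "matrix_wrt bs f =
     Matrix.mat (length bs) (length bs) (\<lambda>(i, j). representation (set bs) (f (bs ! j)) (bs ! i))"

text \<open>The characteristic polynomial \<open>det (\<lambda> Id - f)\<close> of the restriction of \<open>f\<close> to a
  finite-dimensional \<open>f\<close>-invariant subspace \<open>S\<close>. The choice of the basis is irrelevant by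
  \<open>char_poly_on_eq\<close> below. For \<open>S = {0}\<close> the value is \<open>1\<close>.\<close>

definition char_poly_on :: "'a::real_vector set \<Rightarrow> ('a \<Rightarrow> 'a) \<Rightarrow> real poly" where
  "char_poly_on S f = char_poly (matrix_wrt (SOME bs. basis_list S bs) f)"

lemma basis_list_nth_mem: "basis_list S bs \<Longrightarrow> k < length bs \<Longrightarrow> bs ! k \<in> S"
  unfolding basis_list_def by (metis nth_mem span_base)

lemma representation_basis_list_nth:
  assumes "basis_list S bs" "i < length bs" "j < length bs"
  shows "representation (set bs) (bs ! j) (bs ! i) = (if i = j then 1 else 0)"
proof -
  have "independent (set bs)" "bs ! j \<in> set bs" "(bs ! j = bs ! i) = (j = i)"
    using assms unfolding basis_list_def by (simp_all add: nth_eq_iff_index_eq)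
  then show ?thesis
    by (auto simp: real_vector.representation_basis)
qed

lemma basis_list_expand:
  assumes "basis_list S bs" "x \<in> S"
  shows "x = (\<Sum>i<length bs. representation (set bs) x (bs ! i) *\<^sub>R bs ! i)"
proof -
  have d: "distinct bs" and i: "independent (set bs)" and x: "x \<in> span (set bs)"
    using assms by (auto simp: basis_list_def)
  have "x = (\<Sum>b\<in>set bs. representation (set bs) x b *\<^sub>R b)"
    using real_vector.sum_representation_eq[OF i x finite_set subset_refl] by simp
  also have "\<dots> = (\<Sum>i<length bs. representation (set bs) x (bs ! i) *\<^sub>R bs ! i)"
    by (rule sum.reindex_bij_betw[symmetric]) (rule bij_betw_nth[OF d refl refl])
  finally show ?thesis .
qed

lemma representation_lincomb:
  assumes "basis_list S bs" "\<And>k. k \<in> K \<Longrightarrow> v k \<in> S"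
  shows "representation (set bs) (\<Sum>k\<in>K. c k *\<^sub>R v k) b
       = (\<Sum>k\<in>K. c k * representation (set bs) (v k) b)"
proof -
  have i: "independent (set bs)" and s: "\<And>k. k \<in> K \<Longrightarrow> v k \<in> span (set bs)"
    using assms by (auto simp: basis_list_def)
  have "representation (set bs) (\<Sum>k\<in>K. c k *\<^sub>R v k) = (\<lambda>b. \<Sum>k\<in>K. representation (set bs) (c k *\<^sub>R v k) b)"
    by (rule real_vector.representation_sum[OF i]) (use s in \<open>auto intro: span_scale\<close>)
  then show ?thesis
    using s by (auto simp: real_vector.representation_scale[OF i] intro!: sum.cong)
qed

lemma transition_inverse:
  assumes "basis_list S bs" "basis_list S cs" "length bs = n" "length cs = n" "i < n" "j < n"
  shows "(\<Sum>k<n. representation (set cs) (bs ! k) (cs ! i) * representation (set bs) (cs ! j) (bs ! k))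
       = (if i = j then 1 else 0)"
proof -
  have S: "\<And>k. k < n \<Longrightarrow> bs ! k \<in> S" "cs ! j \<in> S"
    using basis_list_nth_mem assms by (metis, metis)
  have "representation (set cs) (cs ! j) (cs ! i)
      = representation (set cs) (\<Sum>k<n. representation (set bs) (cs ! j) (bs ! k) *\<^sub>R bs ! k) (cs ! i)"
    by (rule arg_cong[OF basis_list_expand[OF assms(1) S(2), unfolded assms(3)]])
  also have "\<dots> = (\<Sum>k<n. representation (set bs) (cs ! j) (bs ! k) * representation (set cs) (bs ! k) (cs ! i))"
    by (rule representation_lincomb[OF assms(2)]) (use S in auto)
  finally show ?thesis
    using representation_basis_list_nth[OF assms(2), of i j] assms(4-6) by (simp add: mult.commute)
qed

lemma char_poly_matrix_wrt_unique:
  assumes f: "linear f" "f ` S \<subseteq> S" and b: "basis_list S bs" and c: "basis_list S cs"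
  shows "char_poly (matrix_wrt bs f) = char_poly (matrix_wrt cs f)"
proof -
  define n where "n = length bs"
  have lb: "length bs = n" by (simp add: n_def)
  have lc: "length cs = n"
    using b c unfolding basis_list_def n_def
    by (metis distinct_card real_vector.dim_eq_card_independent real_vector.dim_span)
  define P where "P = Matrix.mat n n (\<lambda>(i, j). representation (set bs) (cs ! j) (bs ! i))"
  define Q where "Q = Matrix.mat n n (\<lambda>(i, j). representation (set cs) (bs ! j) (cs ! i))"
  have bS: "\<And>k. k < n \<Longrightarrow> bs ! k \<in> S" and cS: "\<And>k. k < n \<Longrightarrow> cs ! k \<in> S"
    using basis_list_nth_mem[OF b] basis_list_nth_mem[OF c] lb lc by simp_all
  have fS: "\<And>x. x \<in> S \<Longrightarrow> f x \<in> S" using f by auto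
  have PQ: "P * Q = 1\<^sub>m n"
    unfolding P_def Q_def
    by (rule eq_matI) (auto simp: scalar_prod_def atLeast0LessThan transition_inverse[OF c b lc lb])
  have QP: "Q * P = 1\<^sub>m n"
    unfolding P_def Q_def
    by (rule eq_matI) (auto simp: scalar_prod_def atLeast0LessThan transition_inverse[OF b c lb lc])
  have AP: "matrix_wrt bs f * P = P * matrix_wrt cs f"
  proof (rule eq_matI)
    fix i j assume "i < dim_row (P * matrix_wrt cs f)" "j < dim_col (P * matrix_wrt cs f)"
    then have ij: "i < n" "j < n" by (auto simp: P_def matrix_wrt_def lc)
    have "f (cs ! j) = (\<Sum>k<n. representation (set bs) (cs ! j) (bs ! k) *\<^sub>R f (bs ! k))"
      by (rule arg_cong[OF basis_list_expand[OF b cS[OF ij(2)], unfolded lb], of f, THEN trans])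
         (simp add: linear_sum[OF f(1)] linear_scale[OF f(1)])
    then have "representation (set bs) (f (cs ! j)) (bs ! i)
        = (\<Sum>k<n. representation (set bs) (cs ! j) (bs ! k) * representation (set bs) (f (bs ! k)) (bs ! i))"
      using representation_lincomb[OF b, of "{..<n}" "\<lambda>k. f (bs ! k)"
          "\<lambda>k. representation (set bs) (cs ! j) (bs ! k)" "bs ! i"] bS fS by simp
    moreover have "representation (set bs) (f (cs ! j)) (bs ! i)
        = (\<Sum>k<n. representation (set cs) (f (cs ! j)) (cs ! k) * representation (set bs) (cs ! k) (bs ! i))"
      by (rule arg_cong[OF basis_list_expand[OF c fS[OF cS[OF ij(2)]], unfolded lc], THEN trans])
         (rule representation_lincomb[OF b], use cS in simp)
    ultimately show "(matrix_wrt bs f * P) $$ (i, j) = (P * matrix_wrt cs f) $$ (i, j)"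
      using ij by (simp add: P_def matrix_wrt_def lb lc scalar_prod_def atLeast0LessThan mult.commute)
  qed (auto simp: P_def matrix_wrt_def lb lc)
  have carr: "matrix_wrt bs f \<in> carrier_mat n n" "matrix_wrt cs f \<in> carrier_mat n n"
    "P \<in> carrier_mat n n" "Q \<in> carrier_mat n n"
    by (auto simp: P_def Q_def matrix_wrt_def lb lc)
  have "matrix_wrt bs f = matrix_wrt bs f * (P * Q)"
    using carr by (simp add: PQ)
  also have "\<dots> = matrix_wrt bs f * P * Q"
    by (rule assoc_mult_mat[symmetric, OF carr(1) carr(3) carr(4)])
  also have "\<dots> = P * matrix_wrt cs f * Q"
    by (simp only: AP)
  finally have "similar_mat (matrix_wrt bs f) (matrix_wrt cs f)"
    by (rule similar_matI[OF _ PQ QP, rotated]) (use carr in simp)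
  then show ?thesis
    by (rule char_poly_similar)
qed

lemma basis_list_exists:
  fixes S :: "'a::euclidean_space set"
  assumes "subspace S"
  shows "\<exists>bs. basis_list S bs"
proof -
  obtain B where B: "B \<subseteq> S" "independent B" "S \<subseteq> span B"
    by (rule basis_exists)
  have "span B = S"
    using span_minimal[OF B(1) assms] B(3) by (rule subset_antisym)
  moreover obtain bs where "set bs = B" "distinct bs"
    using finite_distinct_list[of B] independent_bound[OF B(2)] by auto
  ultimately have "basis_list S bs"
    using B(2) by (simp add: basis_list_def)
  then show ?thesis
    by (rule exI)
qed

lemma char_poly_on_eq:
  fixes S :: "'a::real_vector set"
  assumes "linear f" "f ` S \<subseteq> S" "basis_list S bs"
  shows "char_poly_on S f = char_poly (matrix_wrt bs f)"
  unfolding char_poly_on_def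
  by (rule char_poly_matrix_wrt_unique[OF assms(1,2) someI[of "basis_list S", OF assms(3)] assms(3)])


section \<open>Algebraic curvature tensors\<close>

definition algebraic_curvature_tensor :: "('a::real_vector \<Rightarrow> 'a \<Rightarrow> 'a \<Rightarrow> 'a \<Rightarrow> real) \<Rightarrow> bool" where
  "algebraic_curvature_tensor R \<longleftrightarrow>
     (\<forall>Y Z W. linear (\<lambda>X. R X Y Z W)) \<and>
     (\<forall>X Z W. linear (\<lambda>Y. R X Y Z W)) \<and>
     (\<forall>X Y W. linear (\<lambda>Z. R X Y Z W)) \<and>
     (\<forall>X Y Z. linear (\<lambda>W. R X Y Z W)) \<and>
     (\<forall>X Y Z W. R X Y Z W = - R Y X Z W) \<and>
     (\<forall>X Y Z W. R X Y Z W = - R X Y W Z) \<and>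
     (\<forall>X Y Z W. R X Y Z W = R Z W X Y) \<and>
     (\<forall>X Y Z W. R X Y Z W + R Y Z X W + R Z X Y W = 0)"

definition curvature_operator ::
  "('a::real_inner \<Rightarrow> 'a \<Rightarrow> 'a \<Rightarrow> 'a \<Rightarrow> real) \<Rightarrow> 'a \<Rightarrow> 'a \<Rightarrow> 'a \<Rightarrow> 'a" where
  "curvature_operator R X Y Z = (THE V. \<forall>W. inner V W = R X Y Z W)"

definition jacobi_operator ::
  "('a::real_inner \<Rightarrow> 'a \<Rightarrow> 'a \<Rightarrow> 'a \<Rightarrow> real) \<Rightarrow> 'a \<Rightarrow> 'a \<Rightarrow> 'a" where
  "jacobi_operator R X Y = curvature_operator R Y X X"

definition jacobi_orthogonal :: "('a::real_inner \<Rightarrow> 'a \<Rightarrow> 'a \<Rightarrow> 'a \<Rightarrow> real) \<Rightarrow> bool" where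
  "jacobi_orthogonal R \<longleftrightarrow>
     (\<forall>X Y. inner X Y = 0 \<longrightarrow> inner (jacobi_operator R X Y) (jacobi_operator R Y X) = 0)"

definition reduced_jacobi_char_poly ::
  "('a::euclidean_space \<Rightarrow> 'a \<Rightarrow> 'a \<Rightarrow> 'a \<Rightarrow> real) \<Rightarrow> 'a \<Rightarrow> real poly" where
  "reduced_jacobi_char_poly R X = char_poly_on (orthogonal_comp {X}) (jacobi_operator R X)"

definition osserman :: "('a::euclidean_space \<Rightarrow> 'a \<Rightarrow> 'a \<Rightarrow> 'a \<Rightarrow> real) \<Rightarrow> bool" where
  "osserman R \<longleftrightarrow>
     (\<forall>X Y. norm X = 1 \<and> norm Y = 1 \<longrightarrow>
        reduced_jacobi_char_poly R X = reduced_jacobi_char_poly R Y)"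

lemma inner_curvature_operator:
  fixes R :: "'a::euclidean_space \<Rightarrow> 'a \<Rightarrow> 'a \<Rightarrow> 'a \<Rightarrow> real"
  assumes "algebraic_curvature_tensor R"
  shows "inner (curvature_operator R X Y Z) W = R X Y Z W"
proof -
  have l: "linear (R X Y Z)"
    using assms by (simp add: algebraic_curvature_tensor_def)
  have "\<exists>!V. \<forall>W. inner V W = R X Y Z W"
  proof (rule ex1I)
    show "\<forall>W. inner (\<Sum>b\<in>Basis. R X Y Z b *\<^sub>R b) W = R X Y Z W"
    proof
      fix W
      have "R X Y Z W = R X Y Z (\<Sum>b\<in>Basis. inner W b *\<^sub>R b)"
        by (simp add: euclidean_representation)
      also have "\<dots> = (\<Sum>b\<in>Basis. inner W b * R X Y Z b)"
        by (simp add: linear_sum[OF l] linear_scale[OF l])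
      finally show "inner (\<Sum>b\<in>Basis. R X Y Z b *\<^sub>R b) W = R X Y Z W"
        by (simp add: inner_sum_left inner_commute[of W] mult.commute)
    qed
    then show "V = (\<Sum>b\<in>Basis. R X Y Z b *\<^sub>R b)" if "\<forall>W. inner V W = R X Y Z W" for V
      using that by (metis vector_eq_rdot)
  qed
  then show ?thesis
    unfolding curvature_operator_def by (rule theI'[THEN spec])
qed

lemma linear_jacobi_operator:
  fixes R :: "'a::euclidean_space \<Rightarrow> 'a \<Rightarrow> 'a \<Rightarrow> 'a \<Rightarrow> real"
  assumes R: "algebraic_curvature_tensor R"
  shows "linear (jacobi_operator R X)"
proof -
  have "\<forall>Y Z W. linear (\<lambda>X. R X Y Z W)"
    using R unfolding algebraic_curvature_tensor_def by (rule conjunct1)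
  then have l: "linear (\<lambda>Y. R Y X X W)" for W
    by (elim allE)
  have j: "inner (jacobi_operator R X Y) W = R Y X X W" for Y W
    by (simp add: jacobi_operator_def inner_curvature_operator[OF R])
  show ?thesis
  proof (rule linearI)
    show "jacobi_operator R X (Y + Z) = jacobi_operator R X Y + jacobi_operator R X Z" for Y Z
    proof (rule vector_eq_rdot[THEN iffD1], rule allI)
      show "inner (jacobi_operator R X (Y + Z)) W
          = inner (jacobi_operator R X Y + jacobi_operator R X Z) W" for W
        using linear_add[OF l, of Y Z W] by (simp only: j inner_add_left)
    qed
    show "jacobi_operator R X (c *\<^sub>R Y) = c *\<^sub>R jacobi_operator R X Y" for c Y
    proof (rule vector_eq_rdot[THEN iffD1], rule allI)
      show "inner (jacobi_operator R X (c *\<^sub>R Y)) W = inner (c *\<^sub>R jacobi_operator R X Y) W" for W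
        using linear_scale[OF l, of c Y W] by (simp add: j)
    qed
  qed
qed

lemma jacobi_operator_orthogonal_comp:
  fixes R :: "'a::euclidean_space \<Rightarrow> 'a \<Rightarrow> 'a \<Rightarrow> 'a \<Rightarrow> real"
  assumes R: "algebraic_curvature_tensor R"
  shows "jacobi_operator R X ` orthogonal_comp {X} \<subseteq> orthogonal_comp {X}"
proof -
  have h: "R Y X X X = - R Y X X X" for Y
    using R unfolding algebraic_curvature_tensor_def by metis
  have "inner X (jacobi_operator R X Y) = 0" for Y
    using h[of Y] by (subst inner_commute) (simp add: jacobi_operator_def inner_curvature_operator[OF R])
  then show ?thesis
    by (auto simp: orthogonal_comp_def real_inner_class.orthogonal_def)
qed

end

theory Submission
  imports Defs
begin

text \<open>Write \<open>J X\<close> for the Jacobi operator of \<open>X\<close>.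

  The hypothesis is used for one thing, the Rakic duality principle (\<open>duality_principle\<close>): for
  orthonormal \<open>X\<close>, \<open>Y\<close>, if \<open>J X Y = c Y\<close> then \<open>J Y X = c X\<close>. Applying Jacobi-orthogonality to the
  orthogonal pair \<open>X + Y\<close>, \<open>Y - X\<close> instead of \<open>X\<close>, \<open>Y\<close> yields \<open>norm (J X Y) = norm (J Y X)\<close>
  (\<open>norm_J_swap\<close>). If \<open>J X Y = c Y\<close>, the vector \<open>J Y X\<close> therefore has norm \<open>|c|\<close>, while the
  symmetries of \<open>R\<close> give \<open>inner (J Y X) X = c\<close>; this is the equality case of the Cauchy-Schwarz
  inequality.

  Duality makes the spectrum of \<open>J X\<close> stationary as \<open>X\<close> moves on the unit sphere. To first order
  an eigenvalue with unit eigenvector \<open>e\<close> changes in a tangent direction \<open>Z\<close> by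
  \<open>2 * inner (J e X) Z\<close>; here \<open>J e X\<close> is a multiple of \<open>X\<close>, and \<open>Z\<close> is orthogonal to \<open>X\<close>. Since
  eigenvalues may collide, the argument is carried out for the sums \<open>\<Sum> p(eigenvalue)\<close> with \<open>p\<close> a
  polynomial, for which no differentiable choice of eigenvectors is needed: a second order expansion
  in terms of two eigenbases (\<open>spectral_sum_remainder\<close>) bounds the change of such a sum along a great
  circle by a constant times the square of the angle, so the sum is constant
  (\<open>spectral_sum_constant\<close>). Any two unit vectors lie on a great circle, and the sums for all \<open>p\<close>
  determine the eigenvalues with their multiplicities (\<open>multiset_eqI_poly_sums\<close>), hence the
  characteristic polynomial.\<close>

section \<open>Orthonormal eigenbases\<close>

text \<open>The eigenvalue of a unit eigenvector \<open>b\<close> is written as \<open>inner (f b) b\<close>, so that no separate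
  eigenvalue function has to be carried along.\<close>

definition orthonormal_eigenbasis :: "('a::real_inner \<Rightarrow> 'a) \<Rightarrow> 'a set \<Rightarrow> 'a set \<Rightarrow> bool" where
  "orthonormal_eigenbasis f S B \<longleftrightarrow>
     (\<forall>b\<in>B. norm b = 1) \<and> (\<forall>b\<in>B. \<forall>c\<in>B. b \<noteq> c \<longrightarrow> inner b c = 0) \<and> span B = S \<and>
     (\<forall>b\<in>B. f b = inner (f b) b *\<^sub>R b)"

lemma orthonormal_eigenbasis_inner:
  assumes "orthonormal_eigenbasis f S B" "b \<in> B" "c \<in> B"
  shows "inner b c = (if b = c then 1 else 0)"
  using assms by (auto simp: orthonormal_eigenbasis_def dot_square_norm)

lemma orthonormal_eigenbasis_eigenvector:
  assumes "orthonormal_eigenbasis f S B" "b \<in> B"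
  shows "f b = inner (f b) b *\<^sub>R b"
  using assms by (auto simp: orthonormal_eigenbasis_def)

lemma orthonormal_eigenbasis_independent:
  assumes "orthonormal_eigenbasis f S B"
  shows "independent B"
proof (rule pairwise_orthogonal_independent)
  show "pairwise real_inner_class.orthogonal B"
    using assms by (auto simp: pairwise_def real_inner_class.orthogonal_def orthonormal_eigenbasis_def)
  show "0 \<notin> B"
    using assms by (auto simp: orthonormal_eigenbasis_def)
qed

lemma orthonormal_eigenbasis_finite:
  fixes B :: "'a::euclidean_space set"
  shows "orthonormal_eigenbasis f S B \<Longrightarrow> finite B"
  using orthonormal_eigenbasis_independent independent_bound by blast

lemma orthonormal_eigenbasis_expand:
  fixes B :: "'a::euclidean_space set"
  assumes B: "orthonormal_eigenbasis f S B" and x: "x \<in> S"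
  shows "x = (\<Sum>b\<in>B. inner x b *\<^sub>R b)"
proof (rule orthonormal_basis_expand[symmetric])
  show "pairwise real_inner_class.orthogonal B"
    using B by (auto simp: pairwise_def real_inner_class.orthogonal_def orthonormal_eigenbasis_def)
qed (use B x orthonormal_eigenbasis_finite[OF B] in \<open>auto simp: orthonormal_eigenbasis_def\<close>)

lemma parseval:
  fixes B :: "'a::euclidean_space set"
  assumes B: "orthonormal_eigenbasis f UNIV B"
  shows "inner x y = (\<Sum>b\<in>B. inner x b * inner y b)"
proof -
  have "inner x y = inner (\<Sum>b\<in>B. inner x b *\<^sub>R b) y"
    using orthonormal_eigenbasis_expand[OF B UNIV_I, of x] by simp
  then show ?thesis
    by (simp add: inner_sum_left inner_commute[of y])
qed

lemma zero_if_quadratic_nonpos: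
  fixes a b :: real
  assumes "\<And>t. a * t + b * t\<^sup>2 \<le> 0"
  shows "a = 0"
proof -
  \<comment> \<open>At \<open>t = a / c\<close> the linear term dominates the quadratic one.\<close>
  define c where "c = 1 + \<bar>b\<bar>"
  have c: "c > 0" "c + b \<ge> 1" by (auto simp: c_def)
  have "a * (a / c) + b * (a / c)\<^sup>2 \<le> 0" by (rule assms)
  then have "(a * (a / c) + b * (a / c)\<^sup>2) * c\<^sup>2 \<le> 0"
    by (rule mult_nonpos_nonneg) simp
  moreover have "(a * (a / c) + b * (a / c)\<^sup>2) * c\<^sup>2 = a\<^sup>2 * (c + b)"
    using c by (simp add: field_simps power2_eq_square)
  ultimately have "a\<^sup>2 * (c + b) \<le> 0" by simp
  then show ?thesis using c by (simp add: mult_le_0_iff)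
qed

text \<open>The eigenvector is a maximum point \<open>v\<close> of the Rayleigh quotient on the unit sphere of \<open>S\<close>.\<close>

lemma self_adjoint_eigenvector_exists:
  fixes f :: "'a::euclidean_space \<Rightarrow> 'a"
  assumes f: "linear f" "f ` S \<subseteq> S" and S: "subspace S" "S \<noteq> {0}"
    and sym: "\<And>x y. inner (f x) y = inner x (f y)"
  obtains v where "v \<in> S" "norm v = 1" "f v = inner (f v) v *\<^sub>R v"
proof -
  let ?K = "S \<inter> sphere 0 1"
  have "compact ?K"
    by (intro closed_Int_compact closed_subspace S compact_sphere)
  moreover have "?K \<noteq> {}"
  proof -
    obtain x where "x \<in> S" "x \<noteq> 0" using S subspace_0 by blast
    then have "(1 / norm x) *\<^sub>R x \<in> ?K" using S by (auto intro: subspace_scale)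
    then show ?thesis by blast
  qed
  moreover have "continuous_on ?K (\<lambda>x. inner (f x) x)"
    by (intro continuous_on_inner linear_continuous_on continuous_on_id)
       (use f linear_conv_bounded_linear in blast)
  ultimately obtain v where v: "v \<in> ?K" and
    max: "\<And>x. x \<in> ?K \<Longrightarrow> inner (f x) x \<le> inner (f v) v"
    using continuous_attains_sup by meson
  define m where "m = inner (f v) v"
  have v': "v \<in> S" "norm v = 1" "inner v v = 1" using v by (auto simp: dot_square_norm)
  have bound: "inner (f x) x \<le> m * (norm x)\<^sup>2" if "x \<in> S" for x
  proof (cases "x = 0")
    case True
    then show ?thesis using linear_0[OF f(1)] by simp
  next
    case False
    then have "(1 / norm x) *\<^sub>R x \<in> ?K" using S that by (auto intro: subspace_scale)
    from max[OF this] have "inner (f x) x / (norm x * norm x) \<le> m"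
      by (simp add: linear_scale[OF f(1)] m_def)
    then show ?thesis using False by (simp add: pos_divide_le_eq power2_eq_square)
  qed
  \<comment> \<open>Moving from \<open>v\<close> in the direction \<open>w\<close> must not raise the Rayleigh quotient to first order.\<close>
  have crit: "inner (f v) w = 0" if w: "w \<in> S" "inner v w = 0" for w
  proof -
    have "2 * inner (f v) w * t + (inner (f w) w - m * (norm w)\<^sup>2) * t\<^sup>2 \<le> 0" for t
    proof -
      have "v + t *\<^sub>R w \<in> S" using S v' w by (auto intro: subspace_add subspace_scale)
      from bound[OF this] have 1: "inner (f (v + t *\<^sub>R w)) (v + t *\<^sub>R w) \<le> m * inner (v + t *\<^sub>R w) (v + t *\<^sub>R w)"
        by (simp add: dot_square_norm)
      have 2: "inner (f (v + t *\<^sub>R w)) (v + t *\<^sub>R w) = m + 2 * t * inner (f v) w + t\<^sup>2 * inner (f w) w"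
        using sym[of w v] by (simp add: linear_add[OF f(1)] linear_scale[OF f(1)] inner_add_left
            inner_add_right m_def power2_eq_square inner_commute)
      have 3: "inner (v + t *\<^sub>R w) (v + t *\<^sub>R w) = 1 + t\<^sup>2 * (norm w)\<^sup>2"
        unfolding power2_norm_eq_inner using w v'
        by (simp add: inner_add_left inner_add_right power2_eq_square inner_commute)
      from 1 show ?thesis unfolding 2 3 by (simp add: algebra_simps)
    qed
    from zero_if_quadratic_nonpos[OF this] show ?thesis by simp
  qed
  \<comment> \<open>This vector is itself an admissible direction \<open>w\<close>, which forces its norm to vanish.\<close>
  let ?w = "f v - m *\<^sub>R v"
  have wS: "?w \<in> S" using S f v' by (auto intro: subspace_diff subspace_scale)
  have wv: "inner v ?w = 0" using v' by (simp add: inner_diff_right m_def inner_commute)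
  have "inner ?w ?w = inner (f v) ?w - m * inner v ?w"
    by (simp add: inner_diff_left)
  also have "\<dots> = 0" using crit[OF wS wv] wv by simp
  finally have "f v = inner (f v) v *\<^sub>R v" by (simp add: m_def)
  with v' show thesis by (intro that)
qed

lemma orthonormal_eigenbasis_insert:
  fixes f :: "'a::euclidean_space \<Rightarrow> 'a"
  assumes S: "subspace S" and v: "v \<in> S" "norm v = 1" "f v = inner (f v) v *\<^sub>R v"
    and B: "orthonormal_eigenbasis f (S \<inter> {x. inner v x = 0}) B"
  shows "orthonormal_eigenbasis f S (insert v B)"
proof -
  have BS: "span B = S \<inter> {x. inner v x = 0}" using B by (simp add: orthonormal_eigenbasis_def)
  then have B': "b \<in> S \<and> inner v b = 0" if "b \<in> B" for b
    using span_base[OF that] by auto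
  have "S \<subseteq> span (insert v B)"
  proof
    fix x assume x: "x \<in> S"
    have "x - inner v x *\<^sub>R v \<in> span B"
      unfolding BS using x v S
      by (auto intro!: subspace_diff subspace_scale simp: inner_diff_right dot_square_norm)
    then show "x \<in> span (insert v B)" by (auto simp: span_insert)
  qed
  moreover have "span (insert v B) \<subseteq> S"
    by (rule span_minimal) (use B' v S in auto)
  ultimately show ?thesis
    using B v B' by (auto simp: orthonormal_eigenbasis_def inner_commute)
qed

text \<open>The spectral theorem: the hyperplane of \<open>S\<close> orthogonal to an eigenvector is invariant because
  \<open>f\<close> is self-adjoint, so eigenvectors can be split off one at a time.\<close>

lemma self_adjoint_eigenbasis_exists:
  fixes f :: "'a::euclidean_space \<Rightarrow> 'a"
  assumes f: "linear f" and sym: "\<And>x y. inner (f x) y = inner x (f y)"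
    and S: "subspace S" "f ` S \<subseteq> S"
  shows "\<exists>B. orthonormal_eigenbasis f S B"
  using S
proof (induction "dim S" arbitrary: S rule: less_induct)
  case less
  show ?case
  proof (cases "S = {0}")
    case True
    then have "orthonormal_eigenbasis f S {}" by (simp add: orthonormal_eigenbasis_def)
    then show ?thesis ..
  next
    case False
    obtain v where v: "v \<in> S" "norm v = 1" "f v = inner (f v) v *\<^sub>R v"
      using self_adjoint_eigenvector_exists[OF f less.prems(2,1) False sym] .
    let ?T = "S \<inter> {x. inner v x = 0}"
    have T: "subspace ?T"
      by (intro subspace_inter less.prems) (simp add: subspace_hyperplane)
    have "v \<notin> ?T" using v by (simp add: dot_square_norm)
    then have "?T \<subset> S" using v(1) by blast
    then have "dim ?T < dim S"
      by (intro dim_psubset) (use T less.prems in \<open>simp add: span_eq_iff[THEN iffD2]\<close>)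
    moreover have "f ` ?T \<subseteq> ?T"
    proof (rule image_subsetI)
      fix x assume x: "x \<in> ?T"
      have "inner v (f x) = inner (f v) x" by (simp add: sym)
      also have "\<dots> = 0" by (subst v(3)) (use x in simp)
      finally show "f x \<in> ?T" using x less.prems(2) by auto
    qed
    ultimately obtain B where "orthonormal_eigenbasis f ?T B"
      using less.hyps T by blast
    then show ?thesis
      using orthonormal_eigenbasis_insert[where f = f] less.prems(1) v by blast
  qed
qed

lemma char_poly_on_eigenbasis:
  fixes f :: "'a::euclidean_space \<Rightarrow> 'a"
  assumes f: "linear f" "f ` S \<subseteq> S" and B: "orthonormal_eigenbasis f S B"
  shows "char_poly_on S f = (\<Prod>b\<in>B. [:- inner (f b) b, 1:])"
proof -
  obtain bs where bs: "set bs = B" "distinct bs"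
    using finite_distinct_list[OF orthonormal_eigenbasis_finite[OF B]] by auto
  have bl: "basis_list S bs"
    using B bs orthonormal_eigenbasis_independent[OF B]
    by (simp add: basis_list_def orthonormal_eigenbasis_def)
  let ?A = "matrix_wrt bs f"
  have entry: "?A $$ (i, j) = (if i = j then inner (f (bs ! i)) (bs ! i) else 0)"
    if "i < length bs" "j < length bs" for i j
  proof -
    have mem: "bs ! j \<in> B" using bs that by auto
    then have sp: "bs ! j \<in> span (set bs)" using bs span_base by blast
    have "representation (set bs) (f (bs ! j)) (bs ! i)
        = representation (set bs) (inner (f (bs ! j)) (bs ! j) *\<^sub>R bs ! j) (bs ! i)"
      using orthonormal_eigenbasis_eigenvector[OF B mem] by simp
    also have "\<dots> = inner (f (bs ! j)) (bs ! j) * (if i = j then 1 else 0)"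
      using bl sp representation_basis_list_nth[OF bl that]
      by (simp add: basis_list_def real_vector.representation_scale)
    finally show ?thesis using that by (simp add: matrix_wrt_def)
  qed
  have dim: "dim_row ?A = length bs" "dim_col ?A = length bs" by (auto simp: matrix_wrt_def)
  have "char_poly_on S f = char_poly ?A"
    by (rule char_poly_on_eq[OF f bl])
  also have "\<dots> = (\<Prod>a\<leftarrow>diag_mat ?A. [:- a, 1:])"
    by (rule char_poly_upper_triangular[of _ "length bs"])
       (auto simp: dim entry intro!: carrier_matI upper_triangularI)
  also have "diag_mat ?A = map (\<lambda>b. inner (f b) b) bs"
    by (rule nth_equalityI) (auto simp: diag_mat_def dim entry)
  also have "(\<Prod>a\<leftarrow>map (\<lambda>b. inner (f b) b) bs. [:- a, 1:]) = (\<Prod>b\<in>B. [:- inner (f b) b, 1:])"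
    using bs by (simp add: comp_def prod.distinct_set_conv_list[symmetric])
  finally show ?thesis .
qed

section \<open>Sums of a polynomial over the spectrum\<close>

text \<open>A polynomial that vanishes at all elements except \<open>a\<close> turns the sum into the multiplicity of
  \<open>a\<close>.\<close>

lemma multiset_eqI_poly_sums:
  fixes M N :: "'a::{field_char_0} multiset"
  assumes "\<And>p. (\<Sum>x\<in>#M. poly p x) = (\<Sum>x\<in>#N. poly p x)"
  shows "M = N"
proof (rule multiset_eqI)
  fix a
  define E where "E = (set_mset M \<union> set_mset N) - {a}"
  define p where "p = (\<Prod>c\<in>E. [:- c, 1:])"
  have fE: "finite E" by (simp add: E_def)
  have pa: "poly p a \<noteq> 0"
    using fE by (auto simp: p_def poly_prod E_def)
  have "(\<Sum>x\<in>#K. poly p x) = of_nat (count K a) * poly p a" if "set_mset K \<subseteq> insert a E" for K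
    using that
  proof (induction K)
    case (add x K)
    have "poly p x = 0" if "x \<in> E" using that fE by (auto simp: p_def poly_prod)
    then show ?case using add by (auto simp: algebra_simps)
  qed simp
  moreover have "set_mset M \<subseteq> insert a E" "set_mset N \<subseteq> insert a E" by (auto simp: E_def)
  ultimately have "of_nat (count M a) * poly p a = of_nat (count N a) * poly p a"
    using assms[of p] by metis
  then show "count M a = count N a" using pa by simp
qed

lemma poly_mean_value:
  fixes p :: "real poly"
  shows "\<exists>x\<in>{min a b..max a b}. poly p b - poly p a = (b - a) * poly (pderiv p) x"
proof (cases a b rule: linorder_cases)
  case less
  from poly_MVT[OF this, of p] show ?thesis by force
next
  case greater
  from poly_MVT[OF this, of p] obtain x where "b < x" "x < a"
    "poly p a - poly p b = (a - b) * poly (pderiv p) x" by blast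
  then show ?thesis by (intro bexI[of _ x]) (auto simp: algebra_simps)
qed auto

lemma poly_second_order_remainder:
  fixes p :: "real poly"
  obtains M where "M \<ge> 0" "\<And>a b. \<bar>a\<bar> \<le> L \<Longrightarrow> \<bar>b\<bar> \<le> L \<Longrightarrow>
           \<bar>poly p b - poly p a - poly (pderiv p) a * (b - a)\<bar> \<le> M * (b - a)\<^sup>2"
proof -
  let ?p'' = "pderiv (pderiv p)"
  have "compact (poly ?p'' ` {-L..L})"
    by (intro compact_continuous_image continuous_intros compact_Icc)
  then obtain M where M: "M > 0" "\<And>a. a \<in> {-L..L} \<Longrightarrow> \<bar>poly ?p'' a\<bar> \<le> M"
    unfolding compact_eq_bounded_closed bounded_pos by auto
  show thesis
  proof
    show "M \<ge> 0" using M by simp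
    fix a b :: real assume ab: "\<bar>a\<bar> \<le> L" "\<bar>b\<bar> \<le> L"
    obtain x where x: "x \<in> {min a b..max a b}" "poly p b - poly p a = (b - a) * poly (pderiv p) x"
      using poly_mean_value by blast
    obtain y where y: "y \<in> {min a x..max a x}"
      "poly (pderiv p) x - poly (pderiv p) a = (x - a) * poly ?p'' y"
      using poly_mean_value by blast
    have "poly p b - poly p a - poly (pderiv p) a * (b - a) = (b - a) * (poly (pderiv p) x - poly (pderiv p) a)"
      using x by (simp add: algebra_simps)
    then have "\<bar>poly p b - poly p a - poly (pderiv p) a * (b - a)\<bar> = \<bar>b - a\<bar> * \<bar>x - a\<bar> * \<bar>poly ?p'' y\<bar>"
      by (simp add: y abs_mult)
    also have "\<dots> \<le> \<bar>b - a\<bar> * \<bar>b - a\<bar> * M"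
      by (intro mult_mono M) (use x y ab in auto)
    finally show "\<bar>poly p b - poly p a - poly (pderiv p) a * (b - a)\<bar> \<le> M * (b - a)\<^sup>2"
      by (simp add: power2_eq_square mult.commute)
  qed
qed

text \<open>The squares \<open>(inner e u)^2\<close> form a doubly stochastic matrix, by Parseval in \<open>E\<close> and in \<open>U\<close>.
  Averaged against it, the scalar first order remainders of \<open>f\<close> add up to that of \<open>trace f(A)\<close>, and
  the squared eigenvalue differences to the squared Hilbert-Schmidt norm of \<open>B - A\<close>. In this way
  traces of operators are compared without differentiating eigenvalues or eigenvectors. In the
  application \<open>f'\<close> is the derivative of \<open>f\<close>.\<close>

lemma spectral_sum_remainder:
  fixes A B :: "'a::euclidean_space \<Rightarrow> 'a"
  assumes E: "orthonormal_eigenbasis A UNIV E" and U: "orthonormal_eigenbasis B UNIV U"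
    and B: "\<And>x y. inner (B x) y = inner x (B y)"
  shows "(\<Sum>u\<in>U. f (inner (B u) u)) - (\<Sum>e\<in>E. f (inner (A e) e))
           - (\<Sum>e\<in>E. f' (inner (A e) e) * inner (B e - A e) e)
       = (\<Sum>e\<in>E. \<Sum>u\<in>U. (inner e u)\<^sup>2 *
           (f (inner (B u) u) - f (inner (A e) e)
             - f' (inner (A e) e) * (inner (B u) u - inner (A e) e)))"
    and "e \<in> E \<Longrightarrow> (\<Sum>u\<in>U. (inner e u)\<^sup>2 * (inner (B u) u - inner (A e) e)\<^sup>2) = (norm (B e - A e))\<^sup>2"
proof -
  let ?l = "\<lambda>e. inner (A e) e" and ?m = "\<lambda>u. inner (B u) u"
  have Bu: "inner (B e) u = ?m u * inner e u" if "u \<in> U" for e u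
    using orthonormal_eigenbasis_eigenvector[OF U that] B by (metis inner_scaleR_right)
  have Eu: "(\<Sum>e\<in>E. (inner e u)\<^sup>2) = 1" if "u \<in> U" for u
    using parseval[OF E, of u u] orthonormal_eigenbasis_inner[OF U that that]
    by (simp add: power2_eq_square inner_commute)
  have Ue: "(\<Sum>u\<in>U. (inner e u)\<^sup>2) = 1" if "e \<in> E" for e
    using parseval[OF U, of e e] orthonormal_eigenbasis_inner[OF E that that]
    by (simp add: power2_eq_square)
  have Be: "inner (B e) e = (\<Sum>u\<in>U. (inner e u)\<^sup>2 * ?m u)" for e
  proof -
    have "inner (B e) e = (\<Sum>u\<in>U. inner (B e) u * inner e u)" by (rule parseval[OF U])
    also have "\<dots> = (\<Sum>u\<in>U. (?m u * inner e u) * inner e u)"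
      by (rule sum.cong[OF refl], subst Bu, assumption, rule refl)
    finally show ?thesis by (simp add: power2_eq_square mult_ac)
  qed
  have D: "inner (B e - A e) u = (?m u - ?l e) * inner e u" if "e \<in> E" "u \<in> U" for e u
  proof -
    have "inner (A e) u = ?l e * inner e u"
      by (subst orthonormal_eigenbasis_eigenvector[OF E that(1)]) simp
    with Bu[OF that(2), of e] show ?thesis by (simp only: inner_diff_left left_diff_distrib)
  qed
  have 1: "(\<Sum>u\<in>U. f (?m u)) = (\<Sum>e\<in>E. \<Sum>u\<in>U. (inner e u)\<^sup>2 * f (?m u))"
    by (subst sum.swap) (simp add: sum_distrib_right[symmetric] Eu)
  have 2: "f (?l e) = (\<Sum>u\<in>U. (inner e u)\<^sup>2 * f (?l e))" if "e \<in> E" for e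
    by (simp only: sum_distrib_right[symmetric] Ue[OF that] mult_1)
  have 3: "(\<Sum>u\<in>U. (inner e u)\<^sup>2 * (f' (?l e) * (?m u - ?l e))) = f' (?l e) * inner (B e - A e) e"
    if "e \<in> E" for e
  proof -
    have "inner (B e - A e) e = (\<Sum>u\<in>U. (inner e u)\<^sup>2 * ?m u) - (\<Sum>u\<in>U. (inner e u)\<^sup>2) * ?l e"
      using Be[of e] Ue[OF that] by (simp only: inner_diff_left mult_1)
    also have "\<dots> = (\<Sum>u\<in>U. (inner e u)\<^sup>2 * (?m u - ?l e))"
      by (simp only: sum_distrib_right sum_subtractf right_diff_distrib)
    finally have "f' (?l e) * inner (B e - A e) e = (\<Sum>u\<in>U. f' (?l e) * ((inner e u)\<^sup>2 * (?m u - ?l e)))"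
      by (simp only: sum_distrib_left)
    then show ?thesis by (simp only: mult.left_commute[of "f' (?l e)"])
  qed
  show "(\<Sum>u\<in>U. f (?m u)) - (\<Sum>e\<in>E. f (?l e)) - (\<Sum>e\<in>E. f' (?l e) * inner (B e - A e) e)
       = (\<Sum>e\<in>E. \<Sum>u\<in>U. (inner e u)\<^sup>2 * (f (?m u) - f (?l e) - f' (?l e) * (?m u - ?l e)))"
    unfolding 1 sum_subtractf[symmetric]
  proof (rule sum.cong[OF refl])
    fix e assume e: "e \<in> E"
    show "(\<Sum>u\<in>U. (inner e u)\<^sup>2 * f (?m u)) - f (?l e) - f' (?l e) * inner (B e - A e) e
        = (\<Sum>u\<in>U. (inner e u)\<^sup>2 * (f (?m u) - f (?l e) - f' (?l e) * (?m u - ?l e)))"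
    proof -
      have "(\<Sum>u\<in>U. (inner e u)\<^sup>2 * (f (?m u) - f (?l e) - f' (?l e) * (?m u - ?l e)))
          = (\<Sum>u\<in>U. (inner e u)\<^sup>2 * f (?m u) - (inner e u)\<^sup>2 * f (?l e)
              - (inner e u)\<^sup>2 * (f' (?l e) * (?m u - ?l e)))"
        by (simp only: right_diff_distrib[of "(inner e _)\<^sup>2"])
      also have "\<dots> = (\<Sum>u\<in>U. (inner e u)\<^sup>2 * f (?m u)) - f (?l e) - f' (?l e) * inner (B e - A e) e"
        by (simp only: sum_subtractf 2[OF e, symmetric] 3[OF e])
      finally show ?thesis ..
    qed
  qed
  show "(\<Sum>u\<in>U. (inner e u)\<^sup>2 * (?m u - ?l e)\<^sup>2) = (norm (B e - A e))\<^sup>2" if "e \<in> E"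
    unfolding dot_square_norm[symmetric]
    unfolding parseval[OF U, of "B e - A e" "B e - A e"]
    by (rule sum.cong[OF refl]) (simp only: D[OF that] power2_eq_square mult_ac)
qed

lemma constant_if_quadratic_modulus:
  fixes F :: "real \<Rightarrow> real"
  assumes "\<And>s t. \<bar>F s - F t\<bar> \<le> C * (s - t)\<^sup>2"
  shows "F s = F t"
proof -
  have "DERIV F t :> 0" for t
    unfolding DERIV_def
  proof (rule Lim_null_comparison)
    show "\<forall>\<^sub>F h in at 0. norm ((F (t + h) - F t) / h) \<le> C * \<bar>h\<bar>"
    proof (rule eventually_at_topological[THEN iffD2], intro exI[of _ UNIV] conjI ballI impI)
      fix h :: real assume "h \<noteq> 0"
      then show "norm ((F (t + h) - F t) / h) \<le> C * \<bar>h\<bar>"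
        using assms[of "t + h" t]
        by (simp add: abs_divide pos_divide_le_eq power2_eq_square mult.assoc)
    qed auto
    have "((\<lambda>h. C * \<bar>h\<bar>) \<longlongrightarrow> C * \<bar>0\<bar>) (at (0::real))"
      by (intro tendsto_intros)
    then show "((\<lambda>h. C * \<bar>h\<bar>) \<longlongrightarrow> 0) (at (0::real))" by simp
  qed
  then show ?thesis using DERIV_isconst_all by blast
qed

text \<open>By \<open>flat\<close> the first order term of the preceding expansion is already quadratic in \<open>s - t\<close>; by
  \<open>lipschitz\<close> so is the remainder. The bound \<open>L\<close> confines all eigenvalues to a compact interval, on
  which the derivatives of \<open>p\<close> are bounded.\<close>

lemma spectral_sum_constant:
  fixes T :: "real \<Rightarrow> 'a::euclidean_space \<Rightarrow> 'a" and E :: "real \<Rightarrow> 'a set" and p :: "real poly"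
  assumes sym: "\<And>t x y. inner (T t x) y = inner x (T t y)"
    and E: "\<And>t. orthonormal_eigenbasis (T t) UNIV (E t)"
    and bounded: "\<And>t x. norm x = 1 \<Longrightarrow> norm (T t x) \<le> L"
    and lipschitz: "\<And>s t x. norm x = 1 \<Longrightarrow> norm (T s x - T t x) \<le> K * \<bar>s - t\<bar>"
    and flat: "\<And>s t e. e \<in> E t \<Longrightarrow> \<bar>inner (T s e - T t e) e\<bar> \<le> H * (s - t)\<^sup>2"
  shows "(\<Sum>e\<in>E s. poly p (inner (T s e) e)) = (\<Sum>e\<in>E t. poly p (inner (T t e) e))"
proof -
  obtain M where M: "M \<ge> 0" "\<And>a b. \<bar>a\<bar> \<le> L \<Longrightarrow> \<bar>b\<bar> \<le> L \<Longrightarrow>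
           \<bar>poly p b - poly p a - poly (pderiv p) a * (b - a)\<bar> \<le> M * (b - a)\<^sup>2"
    using poly_second_order_remainder by blast
  have "compact (poly (pderiv p) ` {-L..L})"
    by (intro compact_continuous_image continuous_intros compact_Icc)
  then obtain D where D: "D > 0" "\<And>a. a \<in> {-L..L} \<Longrightarrow> \<bar>poly (pderiv p) a\<bar> \<le> D"
    unfolding compact_eq_bounded_closed bounded_pos by auto
  have unit: "norm e = 1" if "e \<in> E t" for e t
    using E that unfolding orthonormal_eigenbasis_def by blast
  have ev: "\<bar>inner (T t e) e\<bar> \<le> L" if "e \<in> E t" for e t
    using Cauchy_Schwarz_ineq2[of "T t e" e] bounded[of e t] unit[OF that] by simp
  have card: "card (E t) = DIM('a)" for t
    using orthonormal_eigenbasis_independent[OF E[of t]] E[of t]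
    by (metis dim_UNIV dim_eq_card_independent dim_span orthonormal_eigenbasis_def)
  define F where "F t = (\<Sum>e\<in>E t. poly p (inner (T t e) e))" for t
  let ?q = "poly (pderiv p)"
  have "\<bar>F s - F t\<bar> \<le> (DIM('a) * (D * H) + DIM('a) * (M * K\<^sup>2)) * (s - t)\<^sup>2" for s t
  proof -
    let ?l = "\<lambda>e. inner (T t e) e" and ?m = "\<lambda>u. inner (T s u) u"
    define I where "I = (\<Sum>e\<in>E t. ?q (?l e) * inner (T s e - T t e) e)"
    define J where "J = (\<Sum>e\<in>E t. \<Sum>u\<in>E s. (inner e u)\<^sup>2 *
           (poly p (?m u) - poly p (?l e) - ?q (?l e) * (?m u - ?l e)))"
    have "F s - F t - I = J"
      unfolding F_def I_def J_def by (rule spectral_sum_remainder(1)[OF E E sym])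
    moreover have "\<bar>I\<bar> \<le> (\<Sum>e\<in>E t. D * (H * (s - t)\<^sup>2))"
      unfolding I_def
    proof (rule order_trans[OF sum_abs sum_mono])
      fix e assume e: "e \<in> E t"
      show "\<bar>?q (?l e) * inner (T s e - T t e) e\<bar> \<le> D * (H * (s - t)\<^sup>2)"
        unfolding abs_mult
        by (intro mult_mono D(2) flat[OF e]) (use ev[OF e] D(1) in auto)
    qed
    moreover have "\<bar>J\<bar> \<le> (\<Sum>e\<in>E t. M * (K\<^sup>2 * (s - t)\<^sup>2))"
      unfolding J_def
    proof (rule order_trans[OF sum_abs sum_mono])
      fix e assume e: "e \<in> E t"
      have "\<bar>\<Sum>u\<in>E s. (inner e u)\<^sup>2 * (poly p (?m u) - poly p (?l e) - ?q (?l e) * (?m u - ?l e))\<bar>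
          \<le> (\<Sum>u\<in>E s. (inner e u)\<^sup>2 * (M * (?m u - ?l e)\<^sup>2))"
      proof (rule order_trans[OF sum_abs sum_mono])
        fix u assume u: "u \<in> E s"
        show "\<bar>(inner e u)\<^sup>2 * (poly p (?m u) - poly p (?l e) - ?q (?l e) * (?m u - ?l e))\<bar>
            \<le> (inner e u)\<^sup>2 * (M * (?m u - ?l e)\<^sup>2)"
          unfolding abs_mult using M(2)[OF ev[OF e] ev[OF u]] by (simp add: mult_left_mono)
      qed
      also have "\<dots> = M * (\<Sum>u\<in>E s. (inner e u)\<^sup>2 * (?m u - ?l e)\<^sup>2)"
        by (simp add: sum_distrib_left mult_ac)
      also have "\<dots> = M * (norm (T s e - T t e))\<^sup>2"
        using spectral_sum_remainder(2)[OF E E sym e] by simp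
      also have "\<dots> \<le> M * (K * \<bar>s - t\<bar>)\<^sup>2"
        by (intro mult_left_mono power_mono lipschitz unit[OF e] M) auto
      finally show "\<bar>\<Sum>u\<in>E s. (inner e u)\<^sup>2 * (poly p (?m u) - poly p (?l e) - ?q (?l e) * (?m u - ?l e))\<bar>
          \<le> M * (K\<^sup>2 * (s - t)\<^sup>2)" by (simp add: power_mult_distrib)
    qed
    ultimately have "\<bar>F s - F t\<bar> \<le> DIM('a) * (D * (H * (s - t)\<^sup>2)) + DIM('a) * (M * (K\<^sup>2 * (s - t)\<^sup>2))"
      by (simp add: card)
    then show ?thesis by (simp add: algebra_simps)
  qed
  from constant_if_quadratic_modulus[OF this] show ?thesis by (simp add: F_def)
qed

section \<open>Curvature tensors and the duality principle\<close>

locale curvature_tensor =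
  fixes R :: "'a::euclidean_space \<Rightarrow> 'a \<Rightarrow> 'a \<Rightarrow> 'a \<Rightarrow> real"
  assumes act: "algebraic_curvature_tensor R"
begin

abbreviation "J \<equiv> jacobi_operator R"

lemma linear_slots:
  "linear (\<lambda>X. R X Y Z W)" "linear (\<lambda>Y. R X Y Z W)" "linear (\<lambda>Z. R X Y Z W)"
proof -
  note act' = act[unfolded algebraic_curvature_tensor_def]
  show "linear (\<lambda>X. R X Y Z W)" using act'[THEN conjunct1] by (elim allE)
  show "linear (\<lambda>Y. R X Y Z W)" using act'[THEN conjunct2, THEN conjunct1] by (elim allE)
  show "linear (\<lambda>Z. R X Y Z W)"
    using act'[THEN conjunct2, THEN conjunct2, THEN conjunct1] by (elim allE)
qed

lemmas add_slots = linear_slots[THEN linear_add]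
lemmas diff_slots = linear_slots[THEN linear_diff]
lemmas scale_slots = linear_slots[THEN linear_scale]

lemma antisym_left: "R X Y Z W = - R Y X Z W"
  and antisym_right: "R X Y Z W = - R X Y W Z"
  and pair_sym: "R X Y Z W = R Z W X Y"
  using act unfolding algebraic_curvature_tensor_def by blast+

lemma alternating: "R X X Z W = 0"
  using antisym_left[of X X Z W] by linarith

lemma inner_J: "inner (J X Y) W = R Y X X W"
  by (simp add: jacobi_operator_def inner_curvature_operator[OF act])

lemma eq_by_inner: "(\<And>W. inner x W = inner y W) \<Longrightarrow> x = (y::'a)"
  using vector_eq_rdot by blast

lemma J_self_adjoint: "inner (J X Y) W = inner Y (J X W)"
  unfolding inner_commute[of Y] inner_J
  using pair_sym[of Y X X W] antisym_left[of X W Y X] antisym_right[of W X Y X] by simp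

lemma J_self: "J X X = 0"
  by (rule eq_by_inner) (simp add: inner_J alternating)

lemma J_minus: "J (- X) = J X"
proof
  show "J (- X) Y = J X Y" for Y
    using scale_slots(2)[of Y "-1" X] scale_slots(3)[of _ _ "-1" X]
    by (intro eq_by_inner) (simp add: inner_J)
qed

text \<open>Since \<open>J X\<close> is quadratic in \<open>X\<close>, the mixed term is obtained by polarization.\<close>

lemma J_lincomb:
  "J (a *\<^sub>R X + b *\<^sub>R Z) v = a\<^sup>2 *\<^sub>R J X v + b\<^sup>2 *\<^sub>R J Z v + (a * b) *\<^sub>R (J (X + Z) v - J X v - J Z v)"
  by (rule eq_by_inner)
     (simp add: inner_J add_slots scale_slots inner_add_left inner_diff_left power2_eq_square algebra_simps)

text \<open>On the diagonal the mixed term is a value of \<open>J v\<close>: the roles of the point and of the direction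
  are exchanged by pair symmetry. This is where the duality principle becomes applicable.\<close>

lemma inner_J_lincomb:
  "inner (J (a *\<^sub>R X + b *\<^sub>R Z) v) v
     = a\<^sup>2 * inner (J X v) v + 2 * a * b * inner (J v X) Z + b\<^sup>2 * inner (J Z v) v"
proof -
  have "R v X Z v = R X v v Z"
    using antisym_left[of v X Z v] antisym_right[of X v Z v] by simp
  moreover have "R v Z X v = R X v v Z" by (rule pair_sym)
  ultimately show ?thesis
    by (simp add: inner_J add_slots scale_slots power2_eq_square algebra_simps)
qed

lemma J_bounded: "\<exists>L>0. \<forall>X v. norm (J X v) \<le> L * (norm X)\<^sup>2 * norm v"
proof -
  let ?C = "curvature_operator R"
  have bil: "bilinear (?C b)" for b
    unfolding bilinear_def
    by (intro conjI allI linearI eq_by_inner)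
       (simp_all add: inner_curvature_operator[OF act] add_slots scale_slots inner_add_left)
  have "\<exists>K>0. \<forall>X Y. norm (?C b X Y) \<le> norm X * norm Y * K" for b
    using bil[of b] unfolding bilinear_conv_bounded_bilinear by (rule bounded_bilinear.pos_bounded)
  then obtain K where K: "\<And>b. K b > 0" "\<And>b X Y. norm (?C b X Y) \<le> norm X * norm Y * K b"
    by metis
  show ?thesis
  proof (intro exI[of _ "\<Sum>b\<in>Basis. K b"] conjI allI)
    show "(\<Sum>b\<in>(Basis::'a set). K b) > 0" by (intro sum_pos) (auto simp: K)
    fix X v
    have "J X v = J X (\<Sum>b\<in>Basis. inner v b *\<^sub>R b)" by (simp add: euclidean_representation)
    also have "\<dots> = (\<Sum>b\<in>Basis. inner v b *\<^sub>R J X b)"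
      by (simp add: linear_sum[OF linear_jacobi_operator[OF act]] linear_scale[OF linear_jacobi_operator[OF act]])
    finally have "norm (J X v) \<le> (\<Sum>b\<in>Basis. norm (inner v b *\<^sub>R J X b))"
      by (simp only: norm_sum)
    also have "\<dots> \<le> (\<Sum>b\<in>Basis. norm v * (norm X * norm X * K b))"
      by (intro sum_mono)
         (auto simp: jacobi_operator_def intro!: mult_mono K Basis_le_norm)
    finally show "norm (J X v) \<le> (\<Sum>b\<in>Basis. K b) * (norm X)\<^sup>2 * norm v"
      by (simp add: sum_distrib_left sum_distrib_right power2_eq_square mult_ac)
  qed
qed

lemma eigenbasis_exists:
  "\<exists>B. orthonormal_eigenbasis (J X) (orthogonal_comp {X}) B"
  by (rule self_adjoint_eigenbasis_exists[OF linear_jacobi_operator[OF act] J_self_adjoint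
        subspace_orthogonal_comp jacobi_operator_orthogonal_comp[OF act]])

text \<open>For a unit vector \<open>X\<close> this is an eigenbasis of \<open>J X\<close> on the whole space, adapted to the
  splitting into the line of \<open>X\<close>, on which \<open>J X\<close> vanishes, and its orthogonal complement. It
  accounts for the factor \<open>[:0, 1:]\<close> between the full and the reduced characteristic polynomial.\<close>

definition eigenbasis :: "'a \<Rightarrow> 'a set" where
  "eigenbasis X = insert X (SOME B. orthonormal_eigenbasis (J X) (orthogonal_comp {X}) B)"

lemma orthogonal_comp_singleton: "orthogonal_comp {X} = {x. inner X x = 0}"
  by (auto simp: orthogonal_comp_def real_inner_class.orthogonal_def)

lemma eigenbasis:
  assumes X: "norm X = 1"
  shows "orthonormal_eigenbasis (J X) UNIV (eigenbasis X)"
    and "e \<in> eigenbasis X \<Longrightarrow> e = X \<or> inner X e = 0"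
    and "(\<Prod>e\<in>eigenbasis X. [:- inner (J X e) e, 1:]) = [:0, 1:] * reduced_jacobi_char_poly R X"
proof -
  define B where "B = (SOME B. orthonormal_eigenbasis (J X) (orthogonal_comp {X}) B)"
  have B: "orthonormal_eigenbasis (J X) (orthogonal_comp {X}) B"
    unfolding B_def by (rule someI_ex[OF eigenbasis_exists])
  have eB: "eigenbasis X = insert X B" by (simp add: eigenbasis_def B_def)
  show "orthonormal_eigenbasis (J X) UNIV (eigenbasis X)"
    unfolding eB
    by (rule orthonormal_eigenbasis_insert)
       (use B X in \<open>auto simp: J_self orthogonal_comp_singleton\<close>)
  have perp: "inner X e = 0" if "e \<in> B" for e
  proof -
    have "e \<in> span B" using that by (rule span_base)
    then show ?thesis using B by (simp add: orthonormal_eigenbasis_def orthogonal_comp_singleton)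
  qed
  then show "e \<in> eigenbasis X \<Longrightarrow> e = X \<or> inner X e = 0" by (auto simp: eB)
  have "X \<notin> B" using perp[of X] X by (auto simp: dot_square_norm)
  then have "(\<Prod>e\<in>eigenbasis X. [:- inner (J X e) e, 1:])
      = [:0, 1:] * (\<Prod>e\<in>B. [:- inner (J X e) e, 1:])"
    unfolding eB using orthonormal_eigenbasis_finite[OF B] by (simp add: J_self)
  also have "(\<Prod>e\<in>B. [:- inner (J X e) e, 1:]) = reduced_jacobi_char_poly R X"
    unfolding reduced_jacobi_char_poly_def
    by (rule char_poly_on_eigenbasis[OF linear_jacobi_operator[OF act]
          jacobi_operator_orthogonal_comp[OF act] B, symmetric])
  finally show "(\<Prod>e\<in>eigenbasis X. [:- inner (J X e) e, 1:]) = [:0, 1:] * reduced_jacobi_char_poly R X" .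
qed

end

locale jacobi_orthogonal_tensor = curvature_tensor +
  assumes jo: "jacobi_orthogonal R"
begin

text \<open>For vectors of equal length \<open>X + Y\<close> and \<open>Y - X\<close> are again orthogonal, and their Jacobi vectors
  are proportional to \<open>J X Y - J Y X\<close> and \<open>J X Y + J Y X\<close>.\<close>

lemma norm_J_swap:
  assumes "norm X = norm Y" "inner X Y = 0"
  shows "norm (J X Y) = norm (J Y X)"
proof -
  have "inner (X + Y) (Y - X) = 0"
    using assms by (simp add: inner_add_left inner_diff_right inner_commute[of Y X] dot_square_norm)
  then have "inner (J (X + Y) (Y - X)) (J (Y - X) (X + Y)) = 0"
    using jo unfolding jacobi_orthogonal_def by blast
  moreover have "J (X + Y) (Y - X) = 2 *\<^sub>R (J X Y - J Y X)"
  proof (rule eq_by_inner)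
    fix W
    show "inner (J (X + Y) (Y - X)) W = inner (2 *\<^sub>R (J X Y - J Y X)) W"
      using antisym_left[of Y X X W] antisym_left[of Y X Y W]
      by (simp add: inner_J add_slots diff_slots alternating inner_diff_left)
  qed
  moreover have "J (Y - X) (X + Y) = 2 *\<^sub>R (J X Y + J Y X)"
  proof (rule eq_by_inner)
    fix W
    show "inner (J (Y - X) (X + Y)) W = inner (2 *\<^sub>R (J X Y + J Y X)) W"
      using antisym_left[of Y X X W] antisym_left[of Y X Y W]
      by (simp add: inner_J add_slots diff_slots alternating inner_add_left)
  qed
  ultimately have "inner (J X Y - J Y X) (J X Y + J Y X) = 0" by simp
  then have "(norm (J X Y))\<^sup>2 = (norm (J Y X))\<^sup>2"
    by (simp add: inner_add_right inner_diff_left inner_commute[of "J Y X" "J X Y"] dot_square_norm)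
  then show ?thesis by simp
qed

text \<open>The vector \<open>J Y X\<close> has norm \<open>|c|\<close> and component \<open>c\<close> along the unit vector \<open>X\<close>, which leaves no
  room for any other component.\<close>

lemma duality_principle:
  assumes X: "norm X = 1" and Y: "norm Y = 1" and XY: "inner X Y = 0" and eig: "J X Y = c *\<^sub>R Y"
  shows "J Y X = c *\<^sub>R X"
proof -
  have n: "norm (J Y X) = \<bar>c\<bar>"
    using norm_J_swap[of X Y] assms by simp
  have "R X Y Y X = R Y X X Y" by (rule pair_sym)
  then have "inner (J Y X) X = inner (J X Y) Y" by (simp add: inner_J)
  then have i: "inner (J Y X) X = c" using eig Y by (simp add: dot_square_norm)
  have "(norm (J Y X - c *\<^sub>R X))\<^sup>2 = (norm (J Y X))\<^sup>2 - 2 * c * inner (J Y X) X + c\<^sup>2 * (norm X)\<^sup>2"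
    unfolding power2_norm_eq_inner
    by (simp add: inner_diff_left inner_diff_right inner_commute[of X "J Y X"] power2_eq_square algebra_simps)
  also have "\<dots> = 0" by (simp add: n i X power2_eq_square)
  finally show ?thesis by simp
qed

text \<open>Up to the factor 2, the left-hand side is the derivative of \<open>inner (J X e) e\<close> when \<open>X\<close> moves in
  the tangent direction \<open>Z\<close> and \<open>e\<close> is kept fixed.\<close>

lemma eigenvalues_stationary:
  assumes X: "norm X = 1" and e: "e \<in> eigenbasis X" and Z: "inner X Z = 0"
  shows "inner (J e X) Z = 0"
  using eigenbasis(2)[OF X e]
proof
  assume "e = X"
  then show ?thesis by (simp add: J_self)
next
  assume "inner X e = 0"
  moreover have "norm e = 1" "J X e = inner (J X e) e *\<^sub>R e"
    using eigenbasis(1)[OF X] e unfolding orthonormal_eigenbasis_def by blast+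
  ultimately have "J e X = inner (J X e) e *\<^sub>R X"
    using duality_principle[OF X] by blast
  then have "inner (J e X) Z = inner (J X e) e * inner X Z" by (metis inner_scaleR_left)
  then show ?thesis using Z by simp
qed

text \<open>Seen from \<open>X t\<close>, every point of the circle is \<open>cos h X t + sin h Z t\<close> with the unit tangent
  \<open>Z t\<close>. In the diagonal entries of \<open>J\<close> at an eigenvector of \<open>J (X t)\<close> the mixed term vanishes, and
  what remains is of order \<open>(sin h)^2\<close>.\<close>

lemma spectral_sum_constant_on_circle:
  assumes P: "norm P = 1" and Q: "norm Q = 1" and PQ: "inner P Q = 0"
  defines "X \<equiv> \<lambda>t. cos t *\<^sub>R P + sin t *\<^sub>R Q"
  shows "(\<Sum>e\<in>eigenbasis (X s). poly p (inner (J (X s) e) e))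
       = (\<Sum>e\<in>eigenbasis (X t). poly p (inner (J (X t) e) e))"
proof -
  obtain L where L: "L > 0" "\<And>X v. norm (J X v) \<le> L * (norm X)\<^sup>2 * norm v"
    using J_bounded by blast
  have ip: "inner P P = 1" "inner Q Q = 1" "inner P Q = 0" "inner Q P = 0"
    using P Q PQ by (simp_all add: dot_square_norm inner_commute)
  have innerX: "inner (X s) (X t) = cos (s - t)" for s t
    by (simp add: X_def inner_add_left inner_add_right ip cos_diff)
  have unit: "norm (X t) = 1" for t
    using innerX[of t t] by (simp add: norm_eq_sqrt_inner)
  define Z where "Z t = X (t + pi / 2)" for t
  have XZ: "inner (X t) (Z t) = 0" for t by (simp add: Z_def innerX)
  have uZ: "norm (Z t) = 1" for t by (simp add: Z_def unit)
  have uXZ: "(norm (X t + Z t))\<^sup>2 = 2" for t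
    unfolding power2_norm_eq_inner
    by (simp add: inner_add_left inner_add_right Z_def innerX)
  have rot: "X s = cos (s - t) *\<^sub>R X t + sin (s - t) *\<^sub>R Z t" for s t
  proof -
    have "cos s = cos (s - t) * cos t - sin (s - t) * sin t"
      "sin s = cos (s - t) * sin t + sin (s - t) * cos t"
      using cos_add[of "s - t" t] sin_add[of "s - t" t] by simp_all
    then show ?thesis
      by (simp add: X_def Z_def cos_add sin_add scaleR_add_right algebra_simps flip: scaleR_add_left)
  qed
  have sin: "(sin (s - t))\<^sup>2 \<le> (s - t)\<^sup>2" for s t :: real
    using abs_sin_x_le_abs_x[of "s - t"] by (simp add: abs_le_square_iff)
  \<comment> \<open>In the Lipschitz constant, \<open>J (X t)\<close> and \<open>J (Z t)\<close> contribute \<open>L\<close> each and the mixed term \<open>4 * L\<close>,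
    because \<open>X t + Z t\<close> has squared length 2.\<close>
  show ?thesis
  proof (rule spectral_sum_constant[where T = "\<lambda>t. J (X t)" and E = "\<lambda>t. eigenbasis (X t)"
        and L = L and K = "6 * L" and H = "2 * L"])
    show "inner (J (X t) x) y = inner x (J (X t) y)" for t x y by (rule J_self_adjoint)
    show "orthonormal_eigenbasis (J (X t)) UNIV (eigenbasis (X t))" for t
      by (rule eigenbasis(1)[OF unit])
    show "norm (J (X t) x) \<le> L" if "norm x = 1" for t x
      using L(2)[of "X t" x] by (simp add: unit that)
    show "norm (J (X s) x - J (X t) x) \<le> 6 * L * \<bar>s - t\<bar>" if x: "norm x = 1" for s t x
    proof -
      let ?a = "cos (s - t)" and ?b = "sin (s - t)"
      let ?M = "J (X t + Z t) x - J (X t) x - J (Z t) x"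
      have b1: "norm (J (X t) x) \<le> L" "norm (J (Z t) x) \<le> L" "norm (J (X t + Z t) x) \<le> 2 * L"
        using L(2)[of "X t" x] L(2)[of "Z t" x] L(2)[of "X t + Z t" x]
        by (simp_all add: unit uZ uXZ x)
      have b2: "?b\<^sup>2 \<le> \<bar>?b\<bar>" "\<bar>?a * ?b\<bar> \<le> \<bar>?b\<bar>" "norm ?M \<le> 2 * L + L + L"
      proof -
        have "\<bar>?b\<bar> * \<bar>?b\<bar> \<le> 1 * \<bar>?b\<bar>" by (rule mult_right_mono) simp_all
        then show "?b\<^sup>2 \<le> \<bar>?b\<bar>" by (simp add: power2_eq_square)
        have "\<bar>?a\<bar> * \<bar>?b\<bar> \<le> 1 * \<bar>?b\<bar>" by (rule mult_right_mono) simp_all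
        then show "\<bar>?a * ?b\<bar> \<le> \<bar>?b\<bar>" by (simp add: abs_mult)
        have "norm ?M \<le> norm (J (X t + Z t) x - J (X t) x) + norm (J (Z t) x)"
          by (rule norm_triangle_ineq4)
        also have "norm (J (X t + Z t) x - J (X t) x) \<le> norm (J (X t + Z t) x) + norm (J (X t) x)"
          by (rule norm_triangle_ineq4)
        finally show "norm ?M \<le> 2 * L + L + L" using b1 by simp
      qed
      have diff: "J (X s) x - J (X t) x
          = (- (?b\<^sup>2)) *\<^sub>R J (X t) x + ?b\<^sup>2 *\<^sub>R J (Z t) x + (?a * ?b) *\<^sub>R ?M"
        unfolding rot[of s t] J_lincomb by (simp add: cos_squared_eq algebra_simps)
      have "norm (J (X s) x - J (X t) x) \<le> ?b\<^sup>2 * norm (J (X t) x) + ?b\<^sup>2 * norm (J (Z t) x) + \<bar>?a * ?b\<bar> * norm ?M"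
        unfolding diff by (intro order_trans[OF norm_triangle_ineq] add_mono) simp_all
      also have "\<dots> \<le> \<bar>?b\<bar> * L + \<bar>?b\<bar> * L + \<bar>?b\<bar> * (2 * L + L + L)"
        by (rule add_mono[OF add_mono[OF mult_mono[OF b2(1) b1(1)] mult_mono[OF b2(1) b1(2)]]
              mult_mono[OF b2(2) b2(3)]]) simp_all
      also have "\<dots> = 6 * L * \<bar>?b\<bar>" by simp
      also have "\<dots> \<le> 6 * L * \<bar>s - t\<bar>"
        using L(1) abs_sin_x_le_abs_x by (intro mult_left_mono) simp_all
      finally show ?thesis .
    qed
    show "\<bar>inner (J (X s) e - J (X t) e) e\<bar> \<le> 2 * L * (s - t)\<^sup>2" if e: "e \<in> eigenbasis (X t)" for s t e
    proof -
      let ?b = "sin (s - t)"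
      have ue: "norm e = 1"
        using eigenbasis(1)[OF unit[of t]] e unfolding orthonormal_eigenbasis_def by blast
      have q: "\<bar>inner (J V e) e\<bar> \<le> L" if "norm V = 1" for V
        using Cauchy_Schwarz_ineq2[of "J V e" e] L(2)[of V e] ue that by simp
      have "inner (J (X s) e - J (X t) e) e = ?b\<^sup>2 * (inner (J (Z t) e) e - inner (J (X t) e) e)"
        unfolding inner_diff_left rot[of s t] inner_J_lincomb eigenvalues_stationary[OF unit e XZ]
        by (simp add: cos_squared_eq algebra_simps)
      then have "\<bar>inner (J (X s) e - J (X t) e) e\<bar> = ?b\<^sup>2 * \<bar>inner (J (Z t) e) e - inner (J (X t) e) e\<bar>"
        by (simp add: abs_mult)
      also have "\<dots> \<le> (s - t)\<^sup>2 * (2 * L)"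
        using q[OF unit[of t]] q[OF uZ[of t]] by (intro mult_mono sin) auto
      finally show ?thesis by (simp add: mult.commute)
    qed
  qed
qed

lemma reduced_jacobi_char_poly_eq_if_sums_eq:
  assumes X: "norm X = 1" and Y: "norm Y = 1"
    and sums: "\<And>p. (\<Sum>e\<in>eigenbasis X. poly p (inner (J X e) e)) = (\<Sum>e\<in>eigenbasis Y. poly p (inner (J Y e) e))"
  shows "reduced_jacobi_char_poly R X = reduced_jacobi_char_poly R Y"
proof -
  define ev where "ev X = image_mset (\<lambda>e. inner (J X e) e) (mset_set (eigenbasis X))" for X
  have "(\<Sum>x\<in>#ev V. poly p x) = (\<Sum>e\<in>eigenbasis V. poly p (inner (J V e) e))" for V p
    by (simp add: ev_def sum_unfold_sum_mset multiset.map_comp comp_def)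
  then have "ev X = ev Y" using sums by (intro multiset_eqI_poly_sums) simp
  moreover have "(\<Prod>a\<in>#ev V. [:- a, 1:]) = (\<Prod>e\<in>eigenbasis V. [:- inner (J V e) e, 1:])" for V
    by (simp add: ev_def prod_unfold_prod_mset multiset.map_comp comp_def)
  ultimately have "[:0, 1:] * reduced_jacobi_char_poly R X = [:0, 1:] * reduced_jacobi_char_poly R Y"
    using eigenbasis(3)[OF X] eigenbasis(3)[OF Y] by metis
  then show ?thesis by (metis mult_left_cancel pCons_eq_0_iff zero_neq_one)
qed

lemma reduced_jacobi_char_poly_eq:
  assumes X: "norm X = 1" and Y: "norm Y = 1"
  shows "reduced_jacobi_char_poly R X = reduced_jacobi_char_poly R Y"
proof -
  define c where "c = inner X Y"
  define w where "w = Y - c *\<^sub>R X"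
  have Xw: "inner X w = 0" using X by (simp add: w_def inner_diff_right dot_square_norm c_def)
  have Yw: "Y = c *\<^sub>R X + w" by (simp add: w_def)
  have pyth: "c\<^sup>2 + (norm w)\<^sup>2 = 1"
  proof -
    have "inner Y Y = c\<^sup>2 * inner X X + inner w w"
      unfolding Yw using Xw by (simp add: inner_add_left inner_add_right inner_commute[of w X] power2_eq_square)
    then show ?thesis using X Y by (simp add: dot_square_norm)
  qed
  show ?thesis
  proof (cases "w = 0")
    case True
    then have "c = 1 \<or> c = - 1" using pyth by (simp add: power2_eq_1_iff)
    then have "Y = X \<or> Y = - X" using True Yw by auto
    then show ?thesis
      by (auto simp: reduced_jacobi_char_poly_def J_minus orthogonal_comp_singleton)
  next
    case False
    define Q where "Q = (1 / norm w) *\<^sub>R w"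
    have Q: "norm Q = 1" "inner X Q = 0" using False Xw by (simp_all add: Q_def)
    obtain t where t: "c = cos t" "norm w = sin t" using sincos_total_2pi[OF pyth] by metis
    have Yt: "Y = cos t *\<^sub>R X + sin t *\<^sub>R Q"
      using False Yw by (simp add: Q_def t(1)[symmetric] t(2)[symmetric])
    show ?thesis
    proof (rule reduced_jacobi_char_poly_eq_if_sums_eq[OF X Y])
      show "(\<Sum>e\<in>eigenbasis X. poly p (inner (J X e) e))
          = (\<Sum>e\<in>eigenbasis Y. poly p (inner (J Y e) e))" for p
        using spectral_sum_constant_on_circle[OF X Q, where s = 0 and p = p and t = t] by (simp add: Yt[symmetric])
    qed
  qed
qed

end

theorem corollary1:
  fixes R :: "'a::euclidean_space \<Rightarrow> 'a \<Rightarrow> 'a \<Rightarrow> 'a \<Rightarrow> real"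
  assumes "algebraic_curvature_tensor R"
    and "jacobi_orthogonal R"
  shows "osserman R"
proof -
  interpret jacobi_orthogonal_tensor R
    by unfold_locales (use assms in auto)
  show ?thesis
    unfolding osserman_def using reduced_jacobi_char_poly_eq by blast
qed

end
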